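(* Let $\Lambda$ be a numerical semigroup of genus $g>0$. (a) $t(\Lambda)= g$ if and only if $\Lambda=\langle g+1,\dots, 2g+1\rangle$, that is, $Gaps(\Lambda)=\{ 1,\dots, g\}$. (b) If $g\geq 2$, then $t(\Lambda)=g-1$ if and only if $\Lambda=\langle g, g+2, g+3, \dots, 2g-1, 2g+1\rangle$, that is, $v(\Lambda)=(0,1)$ and $Gaps(\Lambda)=\{1,\dots, g-1\}\cup\{g+1\}$. (c) If $g\geq 5$, then $t(\Lambda)= g-2$ if and only if one of the following holds: - $v(\Lambda)=(1,0,0,1)$ and $Gaps(\Lambda)=\{1,\dots, g-1\}\cup\{g+2\}$; - $v(\Lambda)=(0,1,1,0)$ and $Gaps(\Lambda)=\{1,\dots, g-2\}\cup\{g, g+1\}$; - $v(\Lambda)=(0,1,0,1)$ and $Gaps(\Lambda)=\{1,\dots, g-2\}\cup\{g, g+2\}$. (d) If $g\geq 8$, then $t(\Lambda)=g-3$ if and only if one of the following holds: - $v(\Lambda)=(1,1,0,0,0,1)$ and $Gaps(\Lambda)=\{1,\dots, g-1\}\cup\{g+3\}$; - $v(\Lambda)=(1,0,1,0,0,1)$ and $Gaps(\Lambda)=\{1,\dots, g-2\}\cup\{g,g+3\}$; - $v(\Lambda)=(1,0,0,1,1,0)$ and $Gaps(\Lambda)=\{1,\dots, g-2\}\cup\{g+1, g+2\}$; - $v(\Lambda)=(0,1,1,1,0,0)$ and $Gaps(\Lambda)=\{1,\dots, g-3\}\cup\{g-1, g, g+1\}$; - $v(\Lambda)=(0,1,1,0,1,0)$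 and $Gaps(\Lambda)=\{1,\dots, g-3\}\cup\{g-1, g, g+2\}$; - $v(\Lambda)=(0,1,1,0,0,1)$ and $Gaps(\Lambda)=\{1,\dots, g-3\}\cup\{g-1, g, g+3\}$; - $v(\Lambda)=(0,1,0,1,0,1)$ and $Gaps(\Lambda)=\{1,\dots, g-3\}\cup\{g-1, g+1, g+3\}$.
   Context: A numerical semigroup $\Lambda$ is a subset of $\mathbb{N}_0$ containing $0$, closed under addition, with finite complement in $\mathbb{N}_0$; $\langle a_1,\dots,a_k\rangle$ denotes the set of all non-negative integer combinations of $a_1,\dots,a_k$. The elements of $Gaps(\Lambda)=\mathbb{N}_0\setminus\Lambda$ are its gaps, and the genus $g(\Lambda)$ is the number of gaps. The set of pseudo-Frobenius numbers is $PF(\Lambda)=\{x\in\mathbb{Z}\setminus\Lambda : x+\lambda\in\Lambda \text{ for all } \lambda\in\Lambda\setminus\{0\}\}$ and the type is $t(\Lambda)=|PF(\Lambda)|$. If $\Lambda$ has genus $g>0$ and type $t(\Lambda)=g-\ell$ with $\ell\ge 1$, then $\{1,\dots,g-\ell\}\subseteq Gaps(\Lambda)\subseteq\{1,\dots,g+\ell\}$. The gap vector of $\Lambda$ is the $(0/1)$-vector $v(\Lambda)=(v_1,\dots,v_{2\ell})$, of length $2\ell=2(g-t(\Lambda))$, with $v_i=1$ if $g-\ell+i\in Gaps(\Lambda)$ and $v_i=0$ otherwise. In (b), the list $g, g+2, g+3,\dots,2g-1,2g+1$ consists of $g$, the integers $k$ with $g+2\le k\le 2g-1$ (none if $g=2$),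 and $2g+1$. *)

theory Defs
  imports Main
begin

definition numerical_semigroup :: "nat set \<Rightarrow> bool" where
  "numerical_semigroup \<Lambda> \<longleftrightarrow>
     0 \<in> \<Lambda> \<and> (\<forall>x\<in>\<Lambda>. \<forall>y\<in>\<Lambda>. x + y \<in> \<Lambda>) \<and> finite (UNIV - \<Lambda>)"

text \<open>Intended for finite \<open>A\<close> only, since sums over infinite sets are \<open>0\<close> by convention.\<close>

definition semigroup_span :: "nat set \<Rightarrow> nat set" where
  "semigroup_span A = {\<Sum>a\<in>A. c a * a | c :: nat \<Rightarrow> nat. True}"

definition gaps :: "nat set \<Rightarrow> nat set" where
  "gaps \<Lambda> = UNIV - \<Lambda>"

definition genus :: "nat set \<Rightarrow> nat" where
  "genus \<Lambda> = card (gaps \<Lambda>)"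

text \<open>Pseudo-Frobenius numbers are integers, not only naturals: for \<open>\<Lambda> = UNIV\<close> the only one
  is \<open>-1\<close>.\<close>

definition pseudo_frobenius :: "nat set \<Rightarrow> int set" where
  "pseudo_frobenius \<Lambda> =
     {x. x \<notin> int ` \<Lambda> \<and> (\<forall>l\<in>\<Lambda> - {0}. x + int l \<in> int ` \<Lambda>)}"

definition semigroup_type :: "nat set \<Rightarrow> nat" where
  "semigroup_type \<Lambda> = card (pseudo_frobenius \<Lambda>)"

text \<open>The entries are indexed by \<open>i = 1, \<dots>, 2 * l\<close>. The truncated subtractions are exact
  when the genus \<open>g\<close> is positive, because then the type is at most \<open>g\<close>. For type equal
  to \<open>g\<close> the vector is empty.\<close>

definition gap_vector :: "nat set \<Rightarrow> nat list" where
  "gap_vector \<Lambda> =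
     (let g = genus \<Lambda>; l = g - semigroup_type \<Lambda>
      in map (\<lambda>i. if g - l + i \<in> gaps \<Lambda> then 1 else 0) [1..<2 * l + 1])"

end

theory Submission
  imports Defs
begin

text \<open>If \<open>t = g - l\<close>, then every positive element of \<open>\<Lambda>\<close> exceeds \<open>t\<close>, since
  pseudo-Frobenius numbers are distinct and nonzero modulo it, and every gap \<open>f\<close> satisfies
  \<open>f + t \<le> 2 * g\<close>, since \<open>f - y\<close> is a gap that is not pseudo-Frobenius for each positive
  \<open>y \<in> \<Lambda>\<close> below \<open>f\<close>. So \<open>\<Lambda>\<close> is determined by \<open>g\<close> and its gap vector \<open>v\<close> of length \<open>2 * l\<close>.
  When \<open>3 * l \<le> g + 1\<close>, the gaps that are not pseudo-Frobenius are exactly the \<open>d\<close> for which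
  \<open>v\<close> has a \<open>0\<close> exactly \<open>d\<close> places before a \<open>1\<close>. Hence \<open>t = g - l\<close> iff \<open>v\<close> has \<open>l\<close> ones and
  \<open>l\<close> such distances, and it remains to enumerate these vectors for \<open>l \<le> 3\<close>.\<close>

section \<open>Gaps and pseudo-Frobenius numbers\<close>

lemma numerical_semigroup_mult:
  assumes "numerical_semigroup L" "a \<in> L"
  shows "k * a \<in> L"
  using assms by (induction k) (auto simp: numerical_semigroup_def)

lemma zero_notin_gaps: "numerical_semigroup L \<Longrightarrow> 0 \<notin> gaps L"
  by (auto simp: numerical_semigroup_def gaps_def)

lemma finite_gaps: "numerical_semigroup L \<Longrightarrow> finite (gaps L)"
  by (auto simp: numerical_semigroup_def gaps_def)

lemma gaps_injectD: "gaps L = gaps M \<Longrightarrow> L = M"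
  by (auto simp: gaps_def)

text \<open>Counting is done with this complement of the pseudo-Frobenius numbers among the gaps:
  for positive genus its size is \<open>l = g - t\<close>.\<close>

definition non_pf_gaps :: "nat set \<Rightarrow> nat set" where
  "non_pf_gaps L = {x \<in> gaps L. \<exists>l \<in> L - {0}. x + l \<in> gaps L}"

text \<open>If \<open>x = -d\<close> were negative, subtracting \<open>d\<close> from any positive
  element would stay in \<open>L\<close>. Descent to \<open>0\<close> makes \<open>d\<close> divide
  every element; two consecutive large elements force \<open>d = 1\<close>, and stepping down by
  \<open>1\<close> gives \<open>L = UNIV\<close>, against positive genus.\<close>

lemma pseudo_frobenius_nonneg:
  assumes "numerical_semigroup L" "genus L > 0" "x \<in> pseudo_frobenius L"
  shows "x \<ge> 0"
proof (rule ccontr)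
  assume neg: "\<not> x \<ge> 0"
  have fin: "finite (- L)" using finite_gaps[OF assms(1)] by (simp add: gaps_def Compl_eq_Diff_UNIV)
  have "\<exists>m. m \<in> L \<and> m > 0"
  proof (rule ccontr)
    assume "\<not> ?thesis"
    then have "{0<..} \<subseteq> - L" by auto
    then show False using fin infinite_Ioi finite_subset by blast
  qed
  have step: "l - nat (- x) \<in> L \<and> nat (- x) \<le> l" if "l \<in> L" "l > 0" for l
  proof -
    have "x + int l \<in> int ` L"
      using assms(3) that by (auto simp: pseudo_frobenius_def)
    then obtain y where "y \<in> L" "x + int l = int y" by blast
    moreover from this have "y = l - nat (- x)" "nat (- x) \<le> l" using neg by auto
    ultimately show ?thesis by simp
  qed
  have down: "n \<in> L \<Longrightarrow> nat (- x) dvd n" for n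
  proof (induction n rule: less_induct)
    case (less n)
    show ?case
    proof (cases "n = 0")
      case False
      then have s: "n - nat (- x) \<in> L" "nat (- x) \<le> n" using step less.prems by auto
      moreover have "n - nat (- x) < n" using False neg by auto
      ultimately have "nat (- x) dvd n - nat (- x)" using less.IH by blast
      then show ?thesis using s(2) by (simp add: dvd_diff_nat dvd_minus_self)
    qed simp
  qed
  obtain b where b: "\<And>n. n > b \<Longrightarrow> n \<in> L"
    using fin by (metis ComplI finite_nat_set_iff_bounded_le not_le)
  have "nat (- x) dvd Suc (Suc b) - Suc b"
    by (rule dvd_diff_nat) (auto intro!: down b)
  then have "nat (- x) = 1" by simp
  then have pred: "l - 1 \<in> L" if "l \<in> L" "l > 0" for l using step that by simp
  have "n \<in> L" for n
  proof (cases "n \<le> Suc b")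
    case True
    then show ?thesis
    proof (induction n rule: inc_induct)
      case (step n)
      then show ?case using pred[of "Suc n"] by simp
    qed (simp add: b)
  qed (simp add: b)
  then have "gaps L = {}" by (auto simp: gaps_def)
  then show False using assms(2) by (simp add: genus_def)
qed

text \<open>With negative values excluded by positive genus, the count moves from integers to
  natural numbers.\<close>

lemma pseudo_frobenius_eq:
  assumes "numerical_semigroup L" "genus L > 0"
  shows "pseudo_frobenius L = int ` (gaps L - non_pf_gaps L)"
proof (intro equalityI subsetI)
  fix x assume x: "x \<in> pseudo_frobenius L"
  then obtain y where y: "x = int y"
    using pseudo_frobenius_nonneg[OF assms x] nonneg_int_cases by blast
  show "x \<in> int ` (gaps L - non_pf_gaps L)"
    using x unfolding y
    by (auto simp: pseudo_frobenius_def gaps_def non_pf_gaps_def image_iff simp flip: of_nat_add)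
next
  fix x assume "x \<in> int ` (gaps L - non_pf_gaps L)"
  then show "x \<in> pseudo_frobenius L"
    by (auto simp: pseudo_frobenius_def gaps_def non_pf_gaps_def image_iff simp flip: of_nat_add)
qed

lemma semigroup_type_add_card_non_pf:
  assumes "numerical_semigroup L" "genus L > 0"
  shows "semigroup_type L + card (non_pf_gaps L) = genus L"
proof -
  have sub: "non_pf_gaps L \<subseteq> gaps L" by (auto simp: non_pf_gaps_def)
  have "semigroup_type L = card (gaps L - non_pf_gaps L)"
    unfolding semigroup_type_def pseudo_frobenius_eq[OF assms] by (simp add: card_image)
  then show ?thesis
    using sub finite_gaps[OF assms(1)]
    by (simp add: genus_def card_Diff_subset finite_subset card_mono)
qed

section \<open>Bounds on elements and gaps in terms of the type\<close>

text \<open>Adding a positive multiple of \<open>m\<close> to a pseudo-Frobenius number lands in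
  \<open>L\<close>, so no two of them share a residue modulo \<open>m\<close>. Residue
  \<open>0\<close> is excluded because multiples of \<open>m\<close> lie in \<open>L\<close>, which
  leaves \<open>m - 1\<close> residues.\<close>

lemma semigroup_type_less_element:
  assumes L: "numerical_semigroup L" "genus L > 0" and m: "m \<in> L" "m > 0"
  shows "semigroup_type L < m"
proof -
  let ?P = "gaps L - non_pf_gaps L"
  have add: "x + k * m \<in> L" if "x \<in> ?P" "k > 0" for x k
    using that m numerical_semigroup_mult[OF L(1) m(1), of k]
    by (auto simp: non_pf_gaps_def gaps_def)
  have "inj_on (\<lambda>x. x mod m) ?P"
  proof (rule linorder_inj_onI')
    fix x y assume xy: "x \<in> ?P" "y \<in> ?P" "x < y"
    show "x mod m \<noteq> y mod m"
    proof
      assume "x mod m = y mod m"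
      then have "m dvd y - x" using xy(3) by (metis mod_eq_dvd_iff_nat less_imp_le)
      then obtain k where "y - x = m * k" by (elim dvdE)
      then have "y = x + k * m" "k > 0" using xy(3) by (auto simp: mult.commute intro: gr0I)
      then show False using add[OF xy(1)] xy(2) by (simp add: gaps_def)
    qed
  qed
  moreover have "(\<lambda>x. x mod m) ` ?P \<subseteq> {0<..<m}"
  proof safe
    fix x assume "x \<in> gaps L"
    then have "\<not> m dvd x"
      using numerical_semigroup_mult[OF L(1) m(1)] by (auto simp: gaps_def mult.commute elim: dvdE)
    then show "x mod m \<in> {0<..<m}" using m by (auto simp: mod_greater_zero_iff_not_dvd)
  qed
  ultimately have "card ?P \<le> card {0<..<m}" by (intro card_inj_on_le) auto
  then show ?thesis
    unfolding semigroup_type_def pseudo_frobenius_eq[OF L] using m by (simp add: card_image)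
qed

text \<open>Each \<open>y\<close> with \<open>1 <= y < f\<close> is a gap other than
  \<open>f\<close>, or it lies in \<open>L\<close> and then \<open>f - y\<close> is a gap that
  adding \<open>y\<close> sends to the gap \<open>f\<close>. Counting both kinds gives
  \<open>f - 1 <= (g - 1) + (g - t)\<close>.\<close>

lemma gap_add_type_le:
  assumes L: "numerical_semigroup L" "genus L > 0" and f: "f \<in> gaps L"
  shows "f + semigroup_type L \<le> 2 * genus L"
proof -
  have fin: "finite (gaps L)" "finite (non_pf_gaps L)"
    using finite_gaps[OF L(1)] by (auto simp: non_pf_gaps_def)
  have "{1..<f} \<subseteq> (gaps L - {f}) \<union> (\<lambda>x. f - x) ` non_pf_gaps L"
  proof
    fix y assume y: "y \<in> {1..<f}"
    show "y \<in> (gaps L - {f}) \<union> (\<lambda>x. f - x) ` non_pf_gaps L"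
    proof (cases "y \<in> gaps L")
      case False
      then have yL: "y \<in> L" by (simp add: gaps_def)
      have "f - y \<notin> L"
      proof
        assume "f - y \<in> L"
        then have "f - y + y \<in> L" using yL L(1) by (simp add: numerical_semigroup_def)
        then show False using y f by (simp add: gaps_def)
      qed
      then have "f - y \<in> non_pf_gaps L"
        using y f yL by (auto simp: non_pf_gaps_def gaps_def intro!: bexI[of _ y])
      then have "f - (f - y) \<in> (\<lambda>x. f - x) ` non_pf_gaps L" by blast
      then show ?thesis using y by simp
    qed (use y in auto)
  qed
  then have "card {1..<f} \<le> card ((gaps L - {f}) \<union> (\<lambda>x. f - x) ` non_pf_gaps L)"
    using fin by (intro card_mono) auto
  also have "\<dots> \<le> card (gaps L - {f}) + card (non_pf_gaps L)"
    by (rule order.trans[OF card_Un_le]) (simp add: card_image_le fin)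
  finally have "f - 1 \<le> genus L - 1 + card (non_pf_gaps L)"
    using f fin by (simp add: genus_def)
  then show ?thesis using semigroup_type_add_card_non_pf[OF L] L(2) by linarith
qed

section \<open>Gap sets and zero-one vectors\<close>

text \<open>Lists are indexed from \<open>0\<close>, so entry \<open>i\<close> stands for the number
  \<open>n + i + 1\<close>. For \<open>n = g - l\<close> this is the gap set that a gap vector
  describes.\<close>

definition window_set :: "nat \<Rightarrow> nat list \<Rightarrow> nat set" where
  "window_set n v = {1..n} \<union> (\<lambda>i. Suc (n + i)) ` {i. i < length v \<and> v ! i = 1}"

text \<open>This is \<open>gap_vector\<close> with base point and length as free parameters, so that
  it can be inverted before the type is known.\<close>

definition window_vector :: "nat \<Rightarrow> nat \<Rightarrow> nat set \<Rightarrow> nat list" where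
  "window_vector n k A = map (\<lambda>i. if n + i \<in> A then 1 else 0) [1..<k + 1]"

lemma length_window_vector [simp]: "length (window_vector n k A) = k"
  by (simp add: window_vector_def)

lemma set_window_vector: "set (window_vector n k A) \<subseteq> {0, 1}"
  by (auto simp: window_vector_def)

lemma nth_window_vector:
  "i < k \<Longrightarrow> window_vector n k A ! i = (if Suc (n + i) \<in> A then 1 else 0)"
  by (simp add: window_vector_def del: upt_Suc)

lemma gap_vector_eq_window_vector:
  "gap_vector L = window_vector (genus L - (genus L - semigroup_type L))
     (2 * (genus L - semigroup_type L)) (gaps L)"
  by (simp add: gap_vector_def window_vector_def Let_def)

lemma window_set_window_vector:
  assumes "{1..n} \<subseteq> A" "A \<subseteq> {1..n + k}"
  shows "window_set n (window_vector n k A) = A"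
proof -
  have "x \<in> window_set n (window_vector n k A) \<longleftrightarrow> x \<in> A" for x
  proof (cases "x \<le> n")
    case True
    then show ?thesis using assms by (auto simp: window_set_def)
  next
    case False
    then obtain i where i: "x = Suc (n + i)" by (metis less_imp_Suc_add not_le)
    have "x \<in> window_set n (window_vector n k A) \<longleftrightarrow> i < k \<and> window_vector n k A ! i = 1"
      by (auto simp: window_set_def i)
    also have "\<dots> \<longleftrightarrow> i < k \<and> x \<in> A"
      by (simp add: nth_window_vector i cong: conj_cong)
    also have "\<dots> \<longleftrightarrow> x \<in> A" using assms(2) i by auto
    finally show ?thesis .
  qed
  then show ?thesis by blast
qed

text \<open>\<open>window_set\<close> records only where an entry is \<open>1\<close>; every other
  position is read back as \<open>0\<close>.\<close>

lemma window_vector_window_set: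
  assumes "set v \<subseteq> {0, 1}" "length v = k"
  shows "window_vector n k (window_set n v) = v"
proof (rule nth_equalityI)
  fix i assume i: "i < length (window_vector n k (window_set n v))"
  then have "v ! i \<in> {0, 1}" using assms nth_mem by fastforce
  then show "window_vector n k (window_set n v) ! i = v ! i"
    using i assms(2) by (auto simp: nth_window_vector window_set_def)
qed (use assms in simp)

text \<open>For a gap set of genus \<open>g\<close> and \<open>n = g - l\<close>, this forces
  exactly \<open>l\<close> ones.\<close>

lemma card_window_set: "card (window_set n v) = n + length (filter ((=) 1) v)"
proof -
  have "card (window_set n v) = card {1..n} + card ((\<lambda>i. Suc (n + i)) ` {i. i < length v \<and> v ! i = 1})"
    unfolding window_set_def by (rule card_Un_disjoint) auto
  also have "\<dots> = n + card {i. i < length v \<and> v ! i = 1}"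
    by (simp add: card_image inj_on_def)
  finally show ?thesis by (simp add: length_filter_conv_card eq_commute)
qed

text \<open>An executable list, so that concrete vectors can be tested by evaluation. It has no
  repetitions, hence its length counts the distances.\<close>

definition zero_one_distances :: "nat list \<Rightarrow> nat list" where
  "zero_one_distances v =
     filter (\<lambda>d. list_ex (\<lambda>i. v ! i = 0 \<and> v ! (i + d) = 1) [0..<length v - d]) [1..<length v]"

lemma set_zero_one_distances:
  "set (zero_one_distances v) = {d. \<exists>i. i + d < length v \<and> v ! i = 0 \<and> v ! (i + d) = 1}"
proof -
  have "d \<ge> 1" if "v ! i = 0" "v ! (i + d) = 1" for i d using that by (cases d) auto
  then show ?thesis
    by (fastforce simp: zero_one_distances_def list_ex_iff less_diff_conv)
qed

lemma distinct_zero_one_distances: "distinct (zero_one_distances v)"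
  by (simp add: zero_one_distances_def)

text \<open>The bound on \<open>length v\<close> makes every distance \<open>d < length v\<close> a gap.\<close>

lemma non_pf_gaps_window:
  assumes L: "numerical_semigroup L" and G: "gaps L = window_set n v"
    and v: "set v \<subseteq> {0, 1}" "length v \<le> n + 1"
  shows "non_pf_gaps L = set (zero_one_distances v)"
proof (intro equalityI subsetI)
  fix x assume "x \<in> non_pf_gaps L"
  then obtain l where l: "x \<in> gaps L" "l \<in> L" "l > 0" "x + l \<in> gaps L"
    by (auto simp: non_pf_gaps_def)
  have "l \<notin> window_set n v" using l(2) G by (auto simp: gaps_def)
  \<comment> \<open>Since \<open>1, ..., n\<close> are gaps, \<open>l\<close> lies beyond
    \<open>n\<close> and corresponds to an index \<open>i\<close>. Then \<open>x + l\<close>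
    corresponds to \<open>i + x\<close>, so a \<open>0\<close> and a \<open>1\<close> stand at
    distance \<open>x\<close>.\<close>
  moreover from this have "n < l" using l(3) by (auto simp: window_set_def)
  then obtain i where i: "l = Suc (n + i)" using less_imp_Suc_add by blast
  ultimately have "i < length v \<Longrightarrow> v ! i \<noteq> 1" by (auto simp: window_set_def)
  moreover have "i + x < length v" "v ! (i + x) = 1"
    using l(4) unfolding G i by (auto simp: window_set_def add_ac)
  moreover have "v ! i \<in> {0, 1}" using subsetD[OF v(1) nth_mem[of i]] calculation(2) by simp
  ultimately show "x \<in> set (zero_one_distances v)" by (auto simp: set_zero_one_distances)
next
  fix d assume "d \<in> set (zero_one_distances v)"
  then obtain i where i: "i + d < length v" "v ! i = 0" "v ! (i + d) = 1"
    by (auto simp: set_zero_one_distances)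
  have "d \<ge> 1" using i by (cases d) auto
  then have "d \<in> gaps L" using i v(2) unfolding G by (auto simp: window_set_def)
  moreover have "Suc (n + i) \<in> L - {0}"
  proof -
    have "Suc (n + i) \<notin> gaps L" using i(2) unfolding G by (auto simp: window_set_def)
    then show ?thesis by (simp add: gaps_def)
  qed
  moreover have "d + Suc (n + i) \<in> gaps L"
    using i unfolding G by (auto simp: window_set_def image_iff add.commute intro!: exI[of _ "i + d"])
  ultimately show "d \<in> non_pf_gaps L" unfolding non_pf_gaps_def by blast
qed

section \<open>Types and admissible vectors\<close>

text \<open>The number of ones encodes genus \<open>g\<close>, the number of distances encodes type
  \<open>g - l\<close>. Neither condition mentions \<open>g\<close>, so one finite search for each
  \<open>l\<close> serves all sufficiently large \<open>g\<close>.\<close>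

definition admissible :: "nat \<Rightarrow> nat list list" where
  "admissible l = filter (\<lambda>v. length (filter ((=) 1) v) = l \<and> length (zero_one_distances v) = l)
     (List.n_lists (2 * l) [0, 1])"

lemma in_set_admissible_iff:
  "v \<in> set (admissible l) \<longleftrightarrow> length v = 2 * l \<and> set v \<subseteq> {0, 1} \<and>
     length (filter ((=) 1) v) = l \<and> length (zero_one_distances v) = l"
  by (auto simp: admissible_def set_n_lists)

context
  fixes L :: "nat set" and g l :: nat
  assumes L: "numerical_semigroup L" and g: "genus L = g" "g > 0" and gl: "3 * l \<le> g + 1"
begin

text \<open>With \<open>t = g - l\<close> the two bounds say that every positive element exceeds
  \<open>g - l\<close> and every gap is at most \<open>2 * g - (g - l) = g + l\<close>. Membership
  is open only for the \<open>2 * l\<close> numbers in between.\<close>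

lemma gaps_eq_window_set_gap_vector:
  assumes "semigroup_type L = g - l"
  shows "gap_vector L = window_vector (g - l) (2 * l) (gaps L)"
    and "gaps L = window_set (g - l) (gap_vector L)"
proof -
  have lg: "l \<le> g" using gl g by linarith
  then have "genus L - semigroup_type L = l" using assms g by simp
  then show gv: "gap_vector L = window_vector (g - l) (2 * l) (gaps L)"
    unfolding gap_vector_eq_window_vector by (simp add: g)
  have "{1..g - l} \<subseteq> gaps L"
    using semigroup_type_less_element[OF L] g assms by (fastforce simp: gaps_def)
  moreover have "f \<le> g - l + 2 * l" if "f \<in> gaps L" for f
    using gap_add_type_le[OF L _ that] g lg assms by linarith
  then have "gaps L \<subseteq> {1..g - l + 2 * l}"
    using zero_notin_gaps[OF L] by (fastforce simp: Suc_le_eq intro: gr0I)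
  ultimately show "gaps L = window_set (g - l) (gap_vector L)"
    unfolding gv by (simp add: window_set_window_vector)
qed

lemma semigroup_type_window:
  assumes "gaps L = window_set (g - l) v" "set v \<subseteq> {0, 1}" "length v = 2 * l"
  shows "semigroup_type L + length (zero_one_distances v) = g"
proof -
  \<comment> \<open>\<open>3 * l <= g + 1\<close> amounts to \<open>2 * l <= (g - l) + 1\<close>,
    the length bound of \<open>non_pf_gaps_window\<close>. For \<open>l = 1, 2, 3\<close> it reads
    \<open>g >= 2\<close>, \<open>g >= 5\<close>, \<open>g >= 8\<close>.\<close>
  have "non_pf_gaps L = set (zero_one_distances v)"
    using assms gl by (intro non_pf_gaps_window[OF L]) auto
  then show ?thesis
    using semigroup_type_add_card_non_pf[OF L] g
    by (simp add: distinct_card distinct_zero_one_distances)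
qed

lemma semigroup_type_eq_iff: "semigroup_type L = g - l \<longleftrightarrow> gap_vector L \<in> set (admissible l)"
proof
  assume t: "semigroup_type L = g - l"
  note gv = gaps_eq_window_set_gap_vector[OF t]
  have v: "set (gap_vector L) \<subseteq> {0, 1}" "length (gap_vector L) = 2 * l"
    unfolding gv(1) by (rule set_window_vector) simp
  have "g - l + length (filter ((=) 1) (gap_vector L)) = g"
    using arg_cong[OF gv(2), of card] g(1) by (simp add: card_window_set genus_def)
  moreover have "g - l + length (zero_one_distances (gap_vector L)) = g"
    using semigroup_type_window[OF gv(2) v] t by simp
  moreover have "l \<le> g" using gl g by linarith
  ultimately show "gap_vector L \<in> set (admissible l)"
    unfolding in_set_admissible_iff using v by auto
next
  assume "gap_vector L \<in> set (admissible l)"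
  \<comment> \<open>The gap vector has length \<open>2 * (g - t)\<close>, so its length determines
    the type.\<close>
  then have "2 * (g - semigroup_type L) = 2 * l"
    unfolding in_set_admissible_iff gap_vector_eq_window_vector by (simp add: g)
  moreover have "semigroup_type L \<le> g"
    using semigroup_type_add_card_non_pf[OF L] g by simp
  ultimately show "semigroup_type L = g - l" by simp
qed

text \<open>From right to left, the gap set first fixes the type through the number of distances.
  This gives the base point and length of \<open>gap_vector L\<close>, and the vector can be read
  back.\<close>

lemma gap_vector_eq_iff:
  assumes "v \<in> set (admissible l)"
  shows "gap_vector L = v \<longleftrightarrow> gaps L = window_set (g - l) v"
proof
  assume "gap_vector L = v"
  then show "gaps L = window_set (g - l) v"
    using assms semigroup_type_eq_iff gaps_eq_window_set_gap_vector(2) by auto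
next
  assume G: "gaps L = window_set (g - l) v"
  have v: "set v \<subseteq> {0, 1}" "length v = 2 * l" "length (zero_one_distances v) = l"
    using assms by (auto simp: in_set_admissible_iff)
  have "semigroup_type L = g - l" using semigroup_type_window[OF G v(1,2)] v(3) by simp
  then show "gap_vector L = v"
    using gaps_eq_window_set_gap_vector(1) G window_vector_window_set[OF v(1,2)] by simp
qed

end

section \<open>Enumeration of the admissible vectors for \<open>l <= 3\<close>\<close>

lemma admissible_0: "admissible 0 = [[]]"
  by code_simp

lemma admissible_1: "admissible 1 = [[0, 1]]"
  by code_simp

text \<open>Evaluation tests all \<open>2 ^ (2 * l)\<close> zero-one vectors. Stated for sets, the
  result is independent of the order of enumeration.\<close>

lemma admissible_2: "set (admissible 2) = {[1,0,0,1], [0,1,1,0], [0,1,0,1]}"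
  by code_simp

lemma admissible_3:
  "set (admissible 3) = {[1,1,0,0,0,1], [1,0,1,0,0,1], [1,0,0,1,1,0], [0,1,1,1,0,0],
     [0,1,1,0,1,0], [0,1,1,0,0,1], [0,1,0,1,0,1]}"
  by code_simp

text \<open>The starting point is an argument so that \<open>ones_from_Cons\<close> can unfold a
  concrete vector entry by entry.\<close>

definition ones_from :: "nat \<Rightarrow> nat list \<Rightarrow> nat set" where
  "ones_from k v = (\<lambda>i. k + i) ` {i. i < length v \<and> v ! i = 1}"

lemma window_set_eq_ones_from: "window_set n v = {1..n} \<union> ones_from (Suc n) v"
  by (simp add: window_set_def ones_from_def)

lemma ones_from_Nil: "ones_from k [] = {}"
  by (simp add: ones_from_def)

lemma ones_from_Cons:
  "ones_from k (a # v) = (if a = 1 then {k} else {}) \<union> ones_from (Suc k) v"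
proof -
  have "{i. i < length (a # v) \<and> (a # v) ! i = 1} =
    (if a = 1 then {0} else {}) \<union> Suc ` {i. i < length v \<and> v ! i = 1}"
    by (auto simp: image_iff less_Suc_eq_0_disj)
  then show ?thesis unfolding ones_from_def by (simp only: image_Un image_image) simp
qed

section \<open>Semigroups spanned by generators\<close>

lemma semigroup_span_subset:
  assumes "0 \<in> L" "\<And>x y. x \<in> L \<Longrightarrow> y \<in> L \<Longrightarrow> x + y \<in> L" "A \<subseteq> L"
  shows "semigroup_span A \<subseteq> L"
proof -
  have mult: "k * a \<in> L" if "a \<in> L" for k a using that assms by (induction k) auto
  have "(\<Sum>a\<in>B. c a * a) \<in> L" if "B \<subseteq> A" for B c
    using that
  \<comment> \<open>For infinite \<open>B\<close> the sum is \<open>0\<close> by convention, and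
    \<open>0\<close> lies in \<open>L\<close>.\<close>
  proof (induction B rule: infinite_finite_induct)
    case (insert b B)
    then show ?case using assms mult by (simp add: subset_iff)
  qed (use assms in auto)
  then show ?thesis by (auto simp: semigroup_span_def)
qed

lemma semigroup_span_add:
  assumes "x \<in> semigroup_span A" "y \<in> semigroup_span A"
  shows "x + y \<in> semigroup_span A"
proof -
  obtain c d where "x = (\<Sum>a\<in>A. c a * a)" "y = (\<Sum>a\<in>A. d a * a)"
    using assms by (auto simp: semigroup_span_def)
  then have "x + y = (\<Sum>a\<in>A. (c a + d a) * a)" by (simp add: sum.distrib distrib_right)
  then show ?thesis unfolding semigroup_span_def by (intro CollectI exI[of _ "\<lambda>a. c a + d a"]) simp
qed

lemma semigroup_span_base:
  assumes "finite A" "a \<in> A"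
  shows "a \<in> semigroup_span A"
proof -
  have "(\<Sum>b\<in>A. of_bool (b = a) * b) = (\<Sum>b\<in>A. if b = a then b else 0)"
    by (rule sum.cong) auto
  then have "a = (\<Sum>b\<in>A. of_bool (b = a) * b)" using assms by simp
  then show ?thesis
    unfolding semigroup_span_def by (intro CollectI exI[of _ "\<lambda>b. of_bool (b = a)"]) simp
qed

lemma zero_in_semigroup_span: "0 \<in> semigroup_span A"
  unfolding semigroup_span_def by (intro CollectI exI[of _ "\<lambda>_. 0"]) simp

text \<open>Repeated subtraction of \<open>a\<close> brings \<open>x\<close> into the block of
  \<open>a\<close> consecutive members that starts at \<open>m\<close>.\<close>

lemma semigroup_span_tail:
  assumes "a \<in> semigroup_span A" "a > 0" "{m..<m + a} \<subseteq> semigroup_span A" "x \<ge> m"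
  shows "x \<in> semigroup_span A"
  using assms(4)
proof (induction x rule: less_induct)
  case (less x)
  show ?case
  proof (cases "x < m + a")
    case False
    then have "x - a \<in> semigroup_span A" using less.IH[of "x - a"] assms(2) by simp
    from semigroup_span_add[OF this assms(1)] show ?thesis using False by simp
  qed (use less.prems assms(3) in auto)
qed

text \<open>The generators are \<open>g + 1\<close> consecutive numbers starting at
  \<open>g + 1\<close>, so adding multiples of \<open>g + 1\<close> reaches everything above.
  Nothing else is spanned, as \<open>{0} \<union> {g+1..}\<close> is closed under addition.\<close>

lemma gaps_semigroup_span_interval: "gaps (semigroup_span {g+1..2*g+1}) = {1..g}"
proof -
  let ?S = "semigroup_span {g+1..2*g+1}"
  have up: "?S \<subseteq> {0} \<union> {g+1..}" by (rule semigroup_span_subset) auto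
  have "x \<in> ?S" if "x \<ge> g + 1" for x
    by (rule semigroup_span_tail[of "g+1" _ "g+1"]) (use that in \<open>auto intro: semigroup_span_base\<close>)
  then have "{0} \<union> {g+1..} \<subseteq> ?S" using zero_in_semigroup_span[of "{g+1..2*g+1}"] by blast
  with up have "?S = {0} \<union> {g+1..}" by (rule equalityI)
  then show ?thesis unfolding gaps_def by (simp only:) auto
qed

text \<open>Among the \<open>g\<close> consecutive numbers from \<open>g + 2\<close> to
  \<open>2 * g + 1\<close> only \<open>2 * g\<close> is not a generator, and it equals
  \<open>g + g\<close>; adding multiples of \<open>g\<close> reaches the rest. Conversely,
  \<open>{0, g} \<union> {g+2..}\<close> is closed under addition because
  \<open>2 * g >= g + 2\<close>.\<close>

lemma gaps_semigroup_span_skip: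
  assumes "g \<ge> 2"
  shows "gaps (semigroup_span ({g} \<union> {g+2..2*g-1} \<union> {2*g+1})) = {1..g-1} \<union> {g+1}"
proof -
  let ?A = "{g} \<union> {g+2..2*g-1} \<union> {2*g+1}"
  let ?S = "semigroup_span ?A"
  have up: "?S \<subseteq> {0, g} \<union> {g+2..}" by (rule semigroup_span_subset) (use assms in auto)
  have g: "g \<in> ?S" by (rule semigroup_span_base) auto
  have gg: "2 * g \<in> ?S" using semigroup_span_add[OF g g] by (simp add: mult_2)
  have block: "{g+2..<g+2+g} \<subseteq> ?S"
  proof
    fix x assume x: "x \<in> {g+2..<g+2+g}"
    show "x \<in> ?S"
    proof (cases "x = 2 * g")
      case False
      then have "x \<in> ?A" using x by auto
      then show ?thesis by (intro semigroup_span_base) auto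
    qed (use gg in simp)
  qed
  have "x \<in> ?S" if "x \<ge> g + 2" for x
    by (rule semigroup_span_tail[OF g _ block that]) (use assms in simp)
  then have "{0, g} \<union> {g+2..} \<subseteq> ?S" using g zero_in_semigroup_span[of ?A] by blast
  with up have "?S = {0, g} \<union> {g+2..}" by (rule equalityI)
  then show ?thesis using assms unfolding gaps_def by (simp only:) auto
qed

section \<open>The classification for \<open>l = 0, 1, 2, 3\<close>\<close>

theorem proposition3p8:
  fixes \<Lambda> :: "nat set" and g :: nat
  assumes "numerical_semigroup \<Lambda>"
    and "genus \<Lambda> = g"
    and "g > 0"
  shows
    "((semigroup_type \<Lambda> = g \<longleftrightarrow> \<Lambda> = semigroup_span {g+1..2*g+1}) \<and>
      (\<Lambda> = semigroup_span {g+1..2*g+1} \<longleftrightarrow> gaps \<Lambda> = {1..g})) \<and>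
     (g \<ge> 2 \<longrightarrow>
       (semigroup_type \<Lambda> = g - 1 \<longleftrightarrow>
         \<Lambda> = semigroup_span ({g} \<union> {g+2..2*g-1} \<union> {2*g+1})) \<and>
       (\<Lambda> = semigroup_span ({g} \<union> {g+2..2*g-1} \<union> {2*g+1}) \<longleftrightarrow>
         gap_vector \<Lambda> = [0,1] \<and> gaps \<Lambda> = {1..g-1} \<union> {g+1}) \<and>
       (gap_vector \<Lambda> = [0,1] \<longleftrightarrow> gaps \<Lambda> = {1..g-1} \<union> {g+1})) \<and>
     (g \<ge> 5 \<longrightarrow>
       (semigroup_type \<Lambda> = g - 2 \<longleftrightarrow>
         (gap_vector \<Lambda> = [1,0,0,1] \<and> gaps \<Lambda> = {1..g-1} \<union> {g+2}) \<or>
         (gap_vector \<Lambda> = [0,1,1,0] \<and> gaps \<Lambda> = {1..g-2} \<union> {g, g+1}) \<or>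
         (gap_vector \<Lambda> = [0,1,0,1] \<and> gaps \<Lambda> = {1..g-2} \<union> {g, g+2})) \<and>
       (gap_vector \<Lambda> = [1,0,0,1] \<longleftrightarrow> gaps \<Lambda> = {1..g-1} \<union> {g+2}) \<and>
       (gap_vector \<Lambda> = [0,1,1,0] \<longleftrightarrow> gaps \<Lambda> = {1..g-2} \<union> {g, g+1}) \<and>
       (gap_vector \<Lambda> = [0,1,0,1] \<longleftrightarrow> gaps \<Lambda> = {1..g-2} \<union> {g, g+2})) \<and>
     (g \<ge> 8 \<longrightarrow>
       (semigroup_type \<Lambda> = g - 3 \<longleftrightarrow>
         (gap_vector \<Lambda> = [1,1,0,0,0,1] \<and> gaps \<Lambda> = {1..g-1} \<union> {g+3}) \<or>
         (gap_vector \<Lambda> = [1,0,1,0,0,1] \<and> gaps \<Lambda> = {1..g-2} \<union> {g, g+3}) \<or>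
         (gap_vector \<Lambda> = [1,0,0,1,1,0] \<and> gaps \<Lambda> = {1..g-2} \<union> {g+1, g+2}) \<or>
         (gap_vector \<Lambda> = [0,1,1,1,0,0] \<and> gaps \<Lambda> = {1..g-3} \<union> {g-1, g, g+1}) \<or>
         (gap_vector \<Lambda> = [0,1,1,0,1,0] \<and> gaps \<Lambda> = {1..g-3} \<union> {g-1, g, g+2}) \<or>
         (gap_vector \<Lambda> = [0,1,1,0,0,1] \<and> gaps \<Lambda> = {1..g-3} \<union> {g-1, g, g+3}) \<or>
         (gap_vector \<Lambda> = [0,1,0,1,0,1] \<and> gaps \<Lambda> = {1..g-3} \<union> {g-1, g+1, g+3})) \<and>
       (gap_vector \<Lambda> = [1,1,0,0,0,1] \<longleftrightarrow> gaps \<Lambda> = {1..g-1} \<union> {g+3}) \<and>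
       (gap_vector \<Lambda> = [1,0,1,0,0,1] \<longleftrightarrow> gaps \<Lambda> = {1..g-2} \<union> {g, g+3}) \<and>
       (gap_vector \<Lambda> = [1,0,0,1,1,0] \<longleftrightarrow> gaps \<Lambda> = {1..g-2} \<union> {g+1, g+2}) \<and>
       (gap_vector \<Lambda> = [0,1,1,1,0,0] \<longleftrightarrow> gaps \<Lambda> = {1..g-3} \<union> {g-1, g, g+1}) \<and>
       (gap_vector \<Lambda> = [0,1,1,0,1,0] \<longleftrightarrow> gaps \<Lambda> = {1..g-3} \<union> {g-1, g, g+2}) \<and>
       (gap_vector \<Lambda> = [0,1,1,0,0,1] \<longleftrightarrow> gaps \<Lambda> = {1..g-3} \<union> {g-1, g, g+3}) \<and>
       (gap_vector \<Lambda> = [0,1,0,1,0,1] \<longleftrightarrow> gaps \<Lambda> = {1..g-3} \<union> {g-1, g+1, g+3}))"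
proof -
  note L = assms(1) and g = assms(2,3)
  note type_iff = semigroup_type_eq_iff[OF L g]
  \<comment> \<open>The window equation is the first premise, so that each evaluated window supplies
    \<open>l\<close>, \<open>v\<close> and \<open>A\<close> by unification.\<close>
  have vec_iff: "gap_vector \<Lambda> = v \<longleftrightarrow> gaps \<Lambda> = A"
    if "window_set (g - l) v = A" "3 * l \<le> g + 1" "v \<in> set (admissible l)" for v A l
    using gap_vector_eq_iff[OF L g that(2,3)] unfolding that(1) .
  \<comment> \<open>Numerals become successors, so that intervals split off their top elements and
    both sides of a window equation turn into the same insertions.\<close>
  note window_simps = window_set_eq_ones_from ones_from_Cons ones_from_Nil atLeastAtMostSuc_conv
    insert_commute numeral_eq_Suc
  \<comment> \<open>For \<open>l = 0\<close> the only admissible vector is empty, and its window set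
    is \<open>{1..g}\<close>.\<close>
  have a: "semigroup_type \<Lambda> = g \<longleftrightarrow> gaps \<Lambda> = {1..g}"
    using type_iff[of 0] vec_iff[of 0 "[]", OF refl]
    by (simp add: admissible_0 window_set_eq_ones_from ones_from_Nil)
  have span_a: "\<Lambda> = semigroup_span {g+1..2*g+1} \<longleftrightarrow> gaps \<Lambda> = {1..g}"
    using gaps_semigroup_span_interval gaps_injectD by metis
  have b: "(gap_vector \<Lambda> = [0,1] \<longleftrightarrow> gaps \<Lambda> = {1..g-1} \<union> {g+1}) \<and>
      (semigroup_type \<Lambda> = g - 1 \<longleftrightarrow> gap_vector \<Lambda> = [0,1]) \<and>
      (\<Lambda> = semigroup_span ({g} \<union> {g+2..2*g-1} \<union> {2*g+1}) \<longleftrightarrow> gaps \<Lambda> = {1..g-1} \<union> {g+1})"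
    if ge: "g \<ge> 2"
  proof -
    \<comment> \<open>With \<open>g\<close> written as a successor, the truncated difference
      \<open>g - 1\<close> computes.\<close>
    obtain n where n: "g = Suc n" using ge by (cases g) auto
    have window: "window_set (g - 1) [0,1] = {1..g-1} \<union> {g+1}"
      by (simp add: n window_simps)
    have "semigroup_type \<Lambda> = g - 1 \<longleftrightarrow> gap_vector \<Lambda> = [0,1]"
      using type_iff[of 1] ge unfolding admissible_1 by simp
    moreover have "\<Lambda> = semigroup_span ({g} \<union> {g+2..2*g-1} \<union> {2*g+1}) \<longleftrightarrow>
        gaps \<Lambda> = {1..g-1} \<union> {g+1}"
      using gaps_semigroup_span_skip[OF ge] gaps_injectD by metis
    moreover have "gap_vector \<Lambda> = [0,1] \<longleftrightarrow> gaps \<Lambda> = {1..g-1} \<union> {g+1}"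
      by (rule vec_iff[OF window]) (use ge in \<open>simp_all only: admissible_1, simp_all\<close>)
    ultimately show ?thesis by (intro conjI)
  qed
  have c: "(gap_vector \<Lambda> = [1,0,0,1] \<longleftrightarrow> gaps \<Lambda> = {1..g-1} \<union> {g+2}) \<and>
      (gap_vector \<Lambda> = [0,1,1,0] \<longleftrightarrow> gaps \<Lambda> = {1..g-2} \<union> {g, g+1}) \<and>
      (gap_vector \<Lambda> = [0,1,0,1] \<longleftrightarrow> gaps \<Lambda> = {1..g-2} \<union> {g, g+2}) \<and>
      (semigroup_type \<Lambda> = g - 2 \<longleftrightarrow> gap_vector \<Lambda> \<in> {[1,0,0,1], [0,1,1,0], [0,1,0,1]})"
    if ge: "g \<ge> 5"
  proof -
    obtain n where n: "g = Suc (Suc n)" using ge by (auto dest!: le_Suc_ex simp: numeral_eq_Suc)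
    have window: "window_set (g - 2) [1,0,0,1] = {1..g-1} \<union> {g+2}"
      "window_set (g - 2) [0,1,1,0] = {1..g-2} \<union> {g, g+1}"
      "window_set (g - 2) [0,1,0,1] = {1..g-2} \<union> {g, g+2}"
      by (simp_all add: n window_simps)
    have "3 * 2 \<le> g + 1" using ge by simp
    from type_iff[OF this] this show ?thesis
      by (intro conjI window[THEN vec_iff]) (simp_all only: admissible_2, simp_all)
  qed
  have d: "(gap_vector \<Lambda> = [1,1,0,0,0,1] \<longleftrightarrow> gaps \<Lambda> = {1..g-1} \<union> {g+3}) \<and>
      (gap_vector \<Lambda> = [1,0,1,0,0,1] \<longleftrightarrow> gaps \<Lambda> = {1..g-2} \<union> {g, g+3}) \<and>
      (gap_vector \<Lambda> = [1,0,0,1,1,0] \<longleftrightarrow> gaps \<Lambda> = {1..g-2} \<union> {g+1, g+2}) \<and>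
      (gap_vector \<Lambda> = [0,1,1,1,0,0] \<longleftrightarrow> gaps \<Lambda> = {1..g-3} \<union> {g-1, g, g+1}) \<and>
      (gap_vector \<Lambda> = [0,1,1,0,1,0] \<longleftrightarrow> gaps \<Lambda> = {1..g-3} \<union> {g-1, g, g+2}) \<and>
      (gap_vector \<Lambda> = [0,1,1,0,0,1] \<longleftrightarrow> gaps \<Lambda> = {1..g-3} \<union> {g-1, g, g+3}) \<and>
      (gap_vector \<Lambda> = [0,1,0,1,0,1] \<longleftrightarrow> gaps \<Lambda> = {1..g-3} \<union> {g-1, g+1, g+3}) \<and>
      (semigroup_type \<Lambda> = g - 3 \<longleftrightarrow> gap_vector \<Lambda> \<in> {[1,1,0,0,0,1], [1,0,1,0,0,1],
        [1,0,0,1,1,0], [0,1,1,1,0,0], [0,1,1,0,1,0], [0,1,1,0,0,1], [0,1,0,1,0,1]})"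
    if ge: "g \<ge> 8"
  proof -
    obtain n where n: "g = Suc (Suc (Suc n))" using ge by (auto dest!: le_Suc_ex simp: numeral_eq_Suc)
    have window: "window_set (g - 3) [1,1,0,0,0,1] = {1..g-1} \<union> {g+3}"
      "window_set (g - 3) [1,0,1,0,0,1] = {1..g-2} \<union> {g, g+3}"
      "window_set (g - 3) [1,0,0,1,1,0] = {1..g-2} \<union> {g+1, g+2}"
      "window_set (g - 3) [0,1,1,1,0,0] = {1..g-3} \<union> {g-1, g, g+1}"
      "window_set (g - 3) [0,1,1,0,1,0] = {1..g-3} \<union> {g-1, g, g+2}"
      "window_set (g - 3) [0,1,1,0,0,1] = {1..g-3} \<union> {g-1, g, g+3}"
      "window_set (g - 3) [0,1,0,1,0,1] = {1..g-3} \<union> {g-1, g+1, g+3}"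
      by (simp_all add: n window_simps)
    have "3 * 3 \<le> g + 1" using ge by simp
    from type_iff[OF this] this show ?thesis
      by (intro conjI window[THEN vec_iff]) (simp_all only: admissible_3, simp_all)
  qed
  show ?thesis
    by (intro conjI impI) (simp_all only: a span_a b c d insert_iff empty_iff simp_thms)
qed

end
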